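(* Let Algorithm 1 (described in the context) be run with parameters $\alpha=\frac43$ and $\mu=\frac{23-\sqrt{313}}{18}\approx 0.295$. Then Algorithm 1 is $\frac{18}{23-\sqrt{313}}$-competitive, where $\frac{18}{23-\sqrt{313}}<3.391$, for task graphs following the communication model. That is, for every number $P\ge 1$ of processors and every finite directed acyclic graph of moldable tasks all of which follow the communication model, i.e. $t_j(p)=\frac{w_j}{p}+c_j(p-1)$, the makespan $T$ produced by the algorithm satisfies $T\le \frac{18}{23-\sqrt{313}}\,T^{\mathrm{opt}}$, where $T^{\mathrm{opt}}$ is the optimal offline makespan.
   Context: Problem. A finite DAG $G=(V,E)$ of tasks is to be executed on $P$ identical processors. An edge $(i,j)$ means that task $j$ cannot start before task $i$ is completed. Tasks are moldable: when task $j$ starts, an integer number $p\in\{1,\dots,P\}$ of processors is chosen for it; it then runs without interruption on exactly $p$ processors for time $t_j(p)$. At any time at most $P$ processors are in use. Online setting: a task becomes available (and its parameters become known) only when all its predecessors are completed. The makespan is the completion time of the last task; $T^{\mathrm{opt}}$ is the minimum makespan over all feasible (offline) schedules. Communication model: $t_j(p)=\frac{w_j}{p}+c_j(p-1)$ with reals $w_j>0$, $c_j\ge0$. The area is $a_j(p)=p\,t_j(p)$. Put $p_j^{\max}=\min(P,\tilde p_j)$, where, with $s_j=\sqrt{w_j/c_j}$, $\tilde p_j=\lfloor s_j\rfloor$ if $t_j(\lfloor s_j\rfloor)\le t_j(\lceil s_j\rceil)$ and $\tilde p_j=\lceil s_j\rceil$ otherwise (conventions: $\tilde p_j=+\infty$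 if $c_j=0$; $\tilde p_j=1$ if $c_j>0$ and $s_j<1$). Put $t_j^{\min}=t_j(p_j^{\max})$, $a_j^{\min}=a_j(1)$. Algorithm 1 with parameters $\alpha\ge1$, $\mu\in(0,1/2]$. Processor allocation: when task $j$ becomes available, (Step 1) choose an initial allocation $p_j\in\{1,\dots,p_j^{\max}\}$ minimizing $t_j(p)/t_j^{\min}$ subject to $a_j(p)/a_j^{\min}\le\alpha$; (Step 2) the final allocation is $p_j'=\min(p_j,\lceil\mu P\rceil)$. The task is then inserted into a waiting queue (in arbitrary order). List scheduling: at time $0$ and whenever a running task completes, after newly available tasks have been inserted, scan all tasks in the queue and start each task $j$ immediately on $p'_j$ processors if at least $p'_j$ processors are idle. *)

theory Defs
  imports Complex_Main
begin

section \<open>Moldable task graphs and feasible schedules\<close>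

text \<open>
  A schedule of the task set \<open>V\<close> consists of an allocation \<open>q\<close> (number of processors of each task)
  and start times \<open>\<sigma>\<close>.  The function \<open>t j p\<close> is the execution time of task \<open>j\<close> on \<open>p\<close> processors.
  Task \<open>j\<close> occupies its processors during the half-open interval from \<open>\<sigma> j\<close> to
  \<open>\<sigma> j + t j (q j)\<close>, so that processors released at some instant can be reused at that instant.
\<close>

definition feasible_schedule ::
  "nat \<Rightarrow> 'a set \<Rightarrow> ('a \<times> 'a) set \<Rightarrow> ('a \<Rightarrow> nat \<Rightarrow> real) \<Rightarrow> ('a \<Rightarrow> nat) \<Rightarrow> ('a \<Rightarrow> real) \<Rightarrow> bool" where
  "feasible_schedule P V E t q \<sigma> \<longleftrightarrow>
     (\<forall>j\<in>V. q j \<in> {1..P} \<and> 0 \<le> \<sigma> j) \<and>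
     (\<forall>(i, j)\<in>E. \<sigma> i + t i (q i) \<le> \<sigma> j) \<and>
     (\<forall>\<tau>. (\<Sum>j | j \<in> V \<and> \<sigma> j \<le> \<tau> \<and> \<tau> < \<sigma> j + t j (q j). q j) \<le> P)"

text \<open>The element \<open>0\<close> only matters for the empty task set.\<close>

definition makespan ::
  "'a set \<Rightarrow> ('a \<Rightarrow> nat \<Rightarrow> real) \<Rightarrow> ('a \<Rightarrow> nat) \<Rightarrow> ('a \<Rightarrow> real) \<Rightarrow> real" where
  "makespan V t q \<sigma> = Max (insert 0 ((\<lambda>j. \<sigma> j + t j (q j)) ` V))"

definition opt_makespan ::
  "nat \<Rightarrow> 'a set \<Rightarrow> ('a \<times> 'a) set \<Rightarrow> ('a \<Rightarrow> nat \<Rightarrow> real) \<Rightarrow> real" where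
  "opt_makespan P V E t = Inf {makespan V t q \<sigma> | q \<sigma>. feasible_schedule P V E t q \<sigma>}"


section \<open>The communication model\<close>

definition comm_time :: "real \<Rightarrow> real \<Rightarrow> nat \<Rightarrow> real" where
  "comm_time w c p = w / real p + c * (real p - 1)"

definition comm_area :: "real \<Rightarrow> real \<Rightarrow> nat \<Rightarrow> real" where
  "comm_area w c p = real p * comm_time w c p"

text \<open>Used only for \<open>c > 0\<close>; for \<open>c = 0\<close> its value is to be read as infinity.\<close>

definition p_tilde :: "real \<Rightarrow> real \<Rightarrow> nat" where
  "p_tilde w c =
     (let s = sqrt (w / c) in
      if s < 1 then 1
      else if comm_time w c (nat \<lfloor>s\<rfloor>) \<le> comm_time w c (nat \<lceil>s\<rceil>) then nat \<lfloor>s\<rfloor>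
      else nat \<lceil>s\<rceil>)"

definition p_max :: "nat \<Rightarrow> real \<Rightarrow> real \<Rightarrow> nat" where
  "p_max P w c = (if c = 0 then P else min P (p_tilde w c))"

definition t_min :: "nat \<Rightarrow> real \<Rightarrow> real \<Rightarrow> real" where
  "t_min P w c = comm_time w c (p_max P w c)"

definition a_min :: "real \<Rightarrow> real \<Rightarrow> real" where
  "a_min w c = comm_area w c 1"


section \<open>The online algorithm: processor allocation\<close>

definition initial_allocation :: "nat \<Rightarrow> real \<Rightarrow> real \<Rightarrow> real \<Rightarrow> nat \<Rightarrow> bool" where
  "initial_allocation P \<alpha> w c =
     is_arg_min (\<lambda>p. comm_time w c p / t_min P w c)
       (\<lambda>p. p \<in> {1..p_max P w c} \<and> comm_area w c p / a_min w c \<le> \<alpha>)"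

definition final_allocation :: "nat \<Rightarrow> real \<Rightarrow> nat \<Rightarrow> nat" where
  "final_allocation P \<mu> p = min p (nat \<lceil>\<mu> * real P\<rceil>)"


section \<open>The online algorithm: list scheduling\<close>

text \<open>
  The algorithm is modelled as a transition system.  Its state consists of the time of the last
  processed event, the waiting queue \<open>Q\<close>, and the start times \<open>st\<close> of the tasks started so far
  (\<open>None\<close> for tasks not yet started).  Throughout, \<open>p\<close> is the final allocation.
\<close>

definition completed ::
  "('a \<Rightarrow> nat \<Rightarrow> real) \<Rightarrow> ('a \<Rightarrow> nat) \<Rightarrow> ('a \<rightharpoonup> real) \<Rightarrow> real \<Rightarrow> 'a set" where
  "completed t p st \<tau> = {j. \<exists>s. st j = Some s \<and> s + t j (p j) \<le> \<tau>}"

definition running ::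
  "('a \<Rightarrow> nat \<Rightarrow> real) \<Rightarrow> ('a \<Rightarrow> nat) \<Rightarrow> ('a \<rightharpoonup> real) \<Rightarrow> real \<Rightarrow> 'a set" where
  "running t p st \<tau> = {j. \<exists>s. st j = Some s \<and> \<tau> < s + t j (p j)}"

definition newly_available ::
  "'a set \<Rightarrow> ('a \<times> 'a) set \<Rightarrow> ('a \<Rightarrow> nat \<Rightarrow> real) \<Rightarrow> ('a \<Rightarrow> nat) \<Rightarrow>
   'a list \<Rightarrow> ('a \<rightharpoonup> real) \<Rightarrow> real \<Rightarrow> 'a set" where
  "newly_available V E t p Q st \<tau> =
     {j \<in> V. (\<forall>i. (i, j) \<in> E \<longrightarrow> i \<in> completed t p st \<tau>) \<and> j \<notin> set Q \<and> j \<notin> dom st}"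

text \<open>
  \<open>scan p f Q\<close> goes once through the queue \<open>Q\<close> with \<open>f\<close> idle processors; it returns the list of
  started tasks and the remaining queue.
\<close>

fun scan :: "('a \<Rightarrow> nat) \<Rightarrow> nat \<Rightarrow> 'a list \<Rightarrow> 'a list \<times> 'a list" where
  "scan p f [] = ([], [])"
| "scan p f (j # js) =
     (if p j \<le> f then let (S, R) = scan p (f - p j) js in (j # S, R)
      else let (S, R) = scan p f js in (S, j # R))"

text \<open>
  Processing of the event at time \<open>\<tau>\<close>.  All tasks finishing exactly at \<open>\<tau>\<close> count as completed.
  The newly available tasks are inserted, in any order, at arbitrary positions of the queue.
\<close>

definition process_event ::
  "nat \<Rightarrow> 'a set \<Rightarrow> ('a \<times> 'a) set \<Rightarrow> ('a \<Rightarrow> nat \<Rightarrow> real) \<Rightarrow> ('a \<Rightarrow> nat) \<Rightarrow> real \<Rightarrow>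
   'a list \<Rightarrow> ('a \<rightharpoonup> real) \<Rightarrow> 'a list \<Rightarrow> ('a \<rightharpoonup> real) \<Rightarrow> bool" where
  "process_event P V E t p \<tau> Q st Q' st' \<longleftrightarrow>
     (\<exists>new queue S.
        distinct new \<and> set new = newly_available V E t p Q st \<tau> \<and>
        queue \<in> shuffles Q new \<and>
        scan p (P - (\<Sum>j\<in>running t p st \<tau>. p j)) queue = (S, Q') \<and>
        st' = (\<lambda>j. if j \<in> set S then Some \<tau> else st j))"

definition next_completion ::
  "('a \<Rightarrow> nat \<Rightarrow> real) \<Rightarrow> ('a \<Rightarrow> nat) \<Rightarrow> ('a \<rightharpoonup> real) \<Rightarrow> real \<Rightarrow> real" where
  "next_completion t p st \<tau> = Min ((\<lambda>j. the (st j) + t j (p j)) ` running t p st \<tau>)"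

text \<open>\<open>list_scheduling P V E t p \<tau> Q st\<close>: some run reaches this state after its event at time \<open>\<tau>\<close>.\<close>

inductive list_scheduling ::
  "nat \<Rightarrow> 'a set \<Rightarrow> ('a \<times> 'a) set \<Rightarrow> ('a \<Rightarrow> nat \<Rightarrow> real) \<Rightarrow> ('a \<Rightarrow> nat) \<Rightarrow>
   real \<Rightarrow> 'a list \<Rightarrow> ('a \<rightharpoonup> real) \<Rightarrow> bool"
  for P V E t p where
  start: "process_event P V E t p 0 [] Map.empty Q st \<Longrightarrow> list_scheduling P V E t p 0 Q st"
| completion: "list_scheduling P V E t p \<tau> Q st \<Longrightarrow> running t p st \<tau> \<noteq> {} \<Longrightarrow>
     \<tau>' = next_completion t p st \<tau> \<Longrightarrow> process_event P V E t p \<tau>' Q st Q' st' \<Longrightarrow>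
     list_scheduling P V E t p \<tau>' Q' st'"

text \<open>
  The possible outputs of the algorithm: final allocations \<open>p\<close> and start times \<open>st\<close> of a run that
  has come to an end, that is, in which no task is running any more and hence no further event
  occurs.  Since the allocation of a task depends only on its parameters and \<open>P\<close>, it does not
  matter that \<open>p\<close> is fixed before the run rather than when the tasks become available.
\<close>

definition algorithm_output ::
  "nat \<Rightarrow> 'a set \<Rightarrow> ('a \<times> 'a) set \<Rightarrow> ('a \<Rightarrow> real) \<Rightarrow> ('a \<Rightarrow> real) \<Rightarrow> real \<Rightarrow> real \<Rightarrow>
   ('a \<Rightarrow> nat) \<Rightarrow> ('a \<rightharpoonup> real) \<Rightarrow> bool" where
  "algorithm_output P V E w c \<alpha> \<mu> p st \<longleftrightarrow>
     (\<forall>j\<in>V. \<exists>p\<^sub>0. initial_allocation P \<alpha> (w j) (c j) p\<^sub>0 \<and> p j = final_allocation P \<mu> p\<^sub>0) \<and>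
     (\<exists>\<tau> Q. list_scheduling P V E (\<lambda>j. comm_time (w j) (c j)) p \<tau> Q st \<and>
            running (\<lambda>j. comm_time (w j) (c j)) p st \<tau> = {})"

end

theory Submission
  imports Defs "HOL-Library.Multiset" "HOL-Analysis.Henstock_Kurzweil_Integration"
begin

text \<open>
  Let \<open>K = 1 / \<mu> - 3 / 2\<close>; the value of \<open>\<mu>\<close> is chosen such that \<open>(1 - \<mu>) K = 4 / 3\<close>.  Weigh the two lower
  bounds on the optimum, the \<open>t_min\<close>-length of a chain with \<open>3 / 2\<close> and the work
  \<open>(\<Sum>j. w j) / P\<close> with \<open>K\<close>; together they give \<open>1 / \<mu>\<close>.  At every instant of the run either
  at least \<open>(1 - \<mu>) P\<close> processors are busy, on tasks whose area is at most \<open>4 / 3\<close> of their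
  work, or no available task is waiting and so a task of a suitable chain is running.  A chain task
  \<open>j\<close> pays for its own time, as \<open>t j (p j) \<le> 3 / 2 * t_min + K * w j / P\<close>: if Step 2 did not reduce
  its allocation, then already \<open>t j (p j) \<le> 3 / 2 * t_min\<close>, and otherwise \<open>p j \<ge> \<mu> P\<close> gives
  \<open>w j / p j \<le> (3 / 2 + K) * w j / P\<close>.
\<close>

section \<open>Execution times in the communication model\<close>

lemma comm_time_pos: "w > 0 \<Longrightarrow> c \<ge> 0 \<Longrightarrow> p \<ge> 1 \<Longrightarrow> comm_time w c p > 0"
  by (simp add: comm_time_def add_pos_nonneg)

text \<open>The discrete derivative: the sign of \<open>c * p * (p + 1) - w\<close> decides whether
  one more processor helps, so the lemmas below compare \<open>w\<close> with products of
  consecutive integers.\<close>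

lemma comm_time_Suc_diff:
  assumes "p \<ge> 1"
  shows "comm_time w c (Suc p) - comm_time w c p = (c * (real p * real (Suc p)) - w) / (real p * real (Suc p))"
  using assms by (simp add: comm_time_def divide_simps) (simp add: algebra_simps)

lemma comm_time_antimono:
  assumes "1 \<le> p" "p \<le> n" "\<And>k. p \<le> k \<Longrightarrow> k < n \<Longrightarrow> c * (real k * real (Suc k)) \<le> w"
  shows "comm_time w c n \<le> comm_time w c p"
  using assms(2,3)
proof (induction n rule: dec_induct)
  case (step n)
  have "comm_time w c (Suc n) - comm_time w c n \<le> 0"
    using step assms(1) by (subst comm_time_Suc_diff) (auto intro!: divide_nonpos_nonneg)
  then show ?case using step by fastforce
qed simp

lemma comm_time_mono:
  assumes "1 \<le> n" "n \<le> p" "\<And>k. n \<le> k \<Longrightarrow> k < p \<Longrightarrow> w \<le> c * (real k * real (Suc k))"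
  shows "comm_time w c n \<le> comm_time w c p"
  using assms(2,3)
proof (induction p rule: dec_induct)
  case (step k)
  have "comm_time w c (Suc k) - comm_time w c k \<ge> 0"
    using step assms(1) by (subst comm_time_Suc_diff) (auto intro!: divide_nonneg_nonneg)
  then show ?case using step by fastforce
qed simp

text \<open>For \<open>k < n\<close> both factors of \<open>k * (k + 1)\<close> are at most
  \<open>sqrt (w / c)\<close>, so no increment before \<open>n\<close> is positive.\<close>

lemma comm_time_decreasing_to_floor:
  assumes "c > 0" "w > 0" "1 \<le> p" "p \<le> n" "real n \<le> sqrt (w / c)"
  shows "comm_time w c n \<le> comm_time w c p"
proof (rule comm_time_antimono)
  fix k assume "k < n"
  then have "real k \<le> sqrt (w / c)" "real (Suc k) \<le> sqrt (w / c)" using assms by auto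
  then have "real k * real (Suc k) \<le> sqrt (w / c) * sqrt (w / c)"
    using assms(1,2) by (intro mult_mono) auto
  moreover have "0 \<le> w / c" using assms(1,2) by simp
  ultimately have "real k * real (Suc k) \<le> w / c" by simp
  then show "c * (real k * real (Suc k)) \<le> w" using assms by (simp add: pos_le_divide_eq mult_ac)
qed (use assms in auto)

lemma comm_time_increasing_from_ceiling:
  assumes "c > 0" "w > 0" "1 \<le> n" "n \<le> p" "sqrt (w / c) \<le> real n"
  shows "comm_time w c n \<le> comm_time w c p"
proof (rule comm_time_mono)
  fix k assume "n \<le> k"
  then have "sqrt (w / c) \<le> real k" "sqrt (w / c) \<le> real (Suc k)" using assms by auto
  then have "sqrt (w / c) * sqrt (w / c) \<le> real k * real (Suc k)"
    using assms by (intro mult_mono) auto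
  then have "w / c \<le> real k * real (Suc k)" using assms by simp
  then show "w \<le> c * (real k * real (Suc k))" using assms by (simp add: pos_divide_le_eq mult_ac)
qed (use assms in auto)

text \<open>The time falls up to \<open>sqrt (w / c)\<close> and rises from there on, so floor or
  ceiling is a minimizer. The third claim serves the case that \<open>P\<close> cuts
  \<open>p_max\<close> off below \<open>p_tilde\<close>.\<close>

lemma p_tilde_optimal:
  assumes "c > 0" "w > 0" "1 \<le> p"
  shows "p_tilde w c \<ge> 1" "comm_time w c (p_tilde w c) \<le> comm_time w c p"
    "p \<le> n \<Longrightarrow> n \<le> p_tilde w c \<Longrightarrow> comm_time w c n \<le> comm_time w c p"
proof -
  define s where "s = sqrt (w / c)"
  have "p_tilde w c \<ge> 1 \<and> comm_time w c (p_tilde w c) \<le> comm_time w c p \<and>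
    (p \<le> n \<longrightarrow> n \<le> p_tilde w c \<longrightarrow> comm_time w c n \<le> comm_time w c p)"
  proof (cases "s < 1")
    case True
    then have "p_tilde w c = 1" by (simp add: p_tilde_def s_def)
    moreover have "comm_time w c 1 \<le> comm_time w c p"
      using True assms by (intro comm_time_increasing_from_ceiling) (auto simp: s_def)
    moreover have "n = p" if "p \<le> n" "n \<le> 1" using that assms by simp
    ultimately show ?thesis by auto
  next
    case False
    define f g where "f = nat \<lfloor>s\<rfloor>" and "g = nat \<lceil>s\<rceil>"
    have fg: "1 \<le> f" "real f \<le> s" "s \<le> real g" "f \<le> g" "g \<le> Suc f"
      using False unfolding f_def g_def by linarith+
    have pt: "p_tilde w c = (if comm_time w c f \<le> comm_time w c g then f else g)"
      using False by (simp add: p_tilde_def s_def f_def g_def)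
    have lo: "comm_time w c n \<le> comm_time w c p" if "1 \<le> p" "p \<le> n" "n \<le> f" for p n
      using assms that fg by (intro comm_time_decreasing_to_floor) (auto simp: s_def)
    have hi: "comm_time w c g \<le> comm_time w c p" if "g \<le> p" for p
      using assms that fg by (intro comm_time_increasing_from_ceiling) (auto simp: s_def)
    \<comment> \<open>Since \<open>g \<le> Suc f\<close>, no integer lies strictly between floor and
      ceiling.\<close>
    have "p \<le> f \<or> g \<le> p" using fg by auto
    then have opt: "comm_time w c (p_tilde w c) \<le> comm_time w c p"
      using lo[of p f] hi[of p] assms unfolding pt by fastforce
    have "comm_time w c n \<le> comm_time w c p" if "p \<le> n" "n \<le> p_tilde w c"
    proof (cases "n \<le> f")
      case True then show ?thesis using lo that assms by blast
    next
      case False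
      \<comment> \<open>The range \<open>f < n \<le> p_tilde w c\<close> leaves only
        \<open>n = g\<close>.\<close>
      then have "n = p_tilde w c" using that fg by (auto simp: pt split: if_splits)
      then show ?thesis using opt by simp
    qed
    then show ?thesis using opt fg pt by auto
  qed
  then show "p_tilde w c \<ge> 1" "comm_time w c (p_tilde w c) \<le> comm_time w c p"
    "p \<le> n \<Longrightarrow> n \<le> p_tilde w c \<Longrightarrow> comm_time w c n \<le> comm_time w c p" by auto
qed

lemma p_max_bounds:
  assumes "w > 0" "c \<ge> 0" "P \<ge> 1"
  shows "1 \<le> p_max P w c" "p_max P w c \<le> P"
  using assms p_tilde_optimal(1)[of c w 1] by (auto simp: p_max_def)

text \<open>\<open>p_max\<close> is either a minimizer of the time, or it is \<open>P\<close> and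
  the time is nonincreasing up to there. This makes \<open>t_min\<close> a valid weight in lower
  bounds on the optimum.\<close>

lemma t_min_le:
  assumes "w > 0" "c \<ge> 0" "1 \<le> p" "p \<le> P"
  shows "t_min P w c \<le> comm_time w c p"
proof (cases "c = 0")
  case True
  then show ?thesis using assms by (simp add: t_min_def p_max_def comm_time_def frac_le)
next
  case False
  then show ?thesis
    using p_tilde_optimal(2,3)[of c w p] assms
    by (cases "P \<le> p_tilde w c") (auto simp: t_min_def p_max_def min_def)
qed

lemma t_min_pos: "w > 0 \<Longrightarrow> c \<ge> 0 \<Longrightarrow> P \<ge> 1 \<Longrightarrow> t_min P w c > 0"
  unfolding t_min_def by (intro comm_time_pos p_max_bounds)

section \<open>Areas and the two allocation steps\<close>

lemma comm_area_eq: "p \<ge> 1 \<Longrightarrow> comm_area w c p = w + c * (real p * (real p - 1))"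
  by (simp add: comm_area_def comm_time_def algebra_simps)

lemma comm_area_mono:
  assumes "c \<ge> 0" "1 \<le> p" "p \<le> n"
  shows "comm_area w c p \<le> comm_area w c n"
  using assms by (auto simp: comm_area_eq intro!: mult_left_mono mult_mono)

text \<open>Since \<open>a_min w c = w\<close>, the factor \<open>4 / 3\<close> leaves
  \<open>w / 3\<close> for the communication overhead \<open>c * p * (p - 1)\<close> in the
  area.\<close>

lemma area_ratio_le_iff:
  assumes "w > 0" "p \<ge> 1"
  shows "comm_area w c p / a_min w c \<le> 4 / 3 \<longleftrightarrow> 3 * c * (real p * (real p - 1)) \<le> w"
  using assms by (simp add: a_min_def comm_area_eq divide_simps) (auto simp: algebra_simps)

text \<open>One processor has area ratio 1, so the set of admissible allocations is nonempty; this
  feeds the existence of an output.\<close>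

lemma initial_allocation_exists:
  assumes "w > 0" "c \<ge> 0" "P \<ge> 1"
  shows "\<exists>p. initial_allocation P (4 / 3) w c p"
proof -
  let ?A = "{p \<in> {1..p_max P w c}. comm_area w c p / a_min w c \<le> 4 / 3}"
  have "1 \<in> ?A"
    using assms p_max_bounds(1)[OF assms] area_ratio_le_iff[of w 1 c] by simp
  then have "?A \<noteq> {}" by blast
  then have "\<exists>x. is_arg_min (\<lambda>p. comm_time w c p / t_min P w c) (\<lambda>p. p \<in> ?A) x"
    by (intro ex_is_arg_min_if_finite) auto
  then show ?thesis by (simp add: initial_allocation_def)
qed

text \<open>
  Equality holds for \<open>k = 1\<close> and \<open>m \<in> {2, 3}\<close>; strictly between these integers the
  inequality fails, so integrality of \<open>m\<close> is essential.
\<close>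
lemma allocation_quadratic:
  fixes k m :: nat
  assumes "1 \<le> k"
  shows "(8 * real k + 7) * m \<le> 9 * (real k * real (Suc k)) + 3 * real m * real m"
proof (cases "k = 1")
  case True
  \<comment> \<open>For \<open>k = 1\<close> the claim reads
    \<open>0 \<le> 3 * (m - 2) * (m - 3)\<close>.\<close>
  have "0 \<le> (int m - 2) * (int m - 3)"
    by (cases "m \<le> 2") (auto intro: mult_nonneg_nonneg mult_nonpos_nonpos)
  then have "0 \<le> real_of_int ((int m - 2) * (int m - 3))" by linarith
  then have "0 \<le> (real m - 2) * (real m - 3)" by simp
  then show ?thesis using True by (simp add: algebra_simps)
next
  case False
  then have k: "real k \<ge> 2" using assms by auto
  \<comment> \<open>Complete the square in \<open>m\<close>; the next fact says that the
    discriminant \<open>-44 k^2 + 4 k + 49\<close> is not positive for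
    \<open>k \<ge> 2\<close>.\<close>
  have "0 \<le> (6 * real m - (8 * real k + 7))\<^sup>2" by simp
  moreover have "0 \<le> (real k - 2) * (44 * real k + 84) + 119" using k by simp
  ultimately show ?thesis by (simp add: algebra_simps power2_eq_square)
qed

text \<open>Compare with the largest allocation \<open>k\<close> within the area budget. If
  \<open>k\<close> is below \<open>p_max\<close>, the failure of \<open>k + 1\<close> bounds
  \<open>c\<close> from below; the claim for \<open>k\<close> is hardest at that bound, where it
  becomes \<open>allocation_quadratic\<close>.\<close>

lemma initial_allocation_time:
  assumes "w > 0" "c \<ge> 0" "P \<ge> 1" "initial_allocation P (4 / 3) w c p"
  shows "comm_time w c p \<le> 3 / 2 * t_min P w c"
proof -
  define m where "m = p_max P w c"
  define F where "F = {k \<in> {1..m}. 3 * c * (real k * (real k - 1)) \<le> w}"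
  have m1: "1 \<le> m" using p_max_bounds assms by (simp add: m_def)
  have best: "comm_time w c p \<le> comm_time w c k" if "k \<in> F" for k
  proof -
    have "comm_area w c k / a_min w c \<le> 4 / 3"
      using that assms by (subst area_ratio_le_iff) (auto simp: F_def)
    then have "\<not> comm_time w c k / t_min P w c < comm_time w c p / t_min P w c"
      using that assms(4) by (auto simp: initial_allocation_def is_arg_min_def F_def m_def)
    then show ?thesis using t_min_pos[of w c P] assms by (simp add: divide_less_cancel)
  qed
  have "1 \<in> F" using assms m1 by (simp add: F_def)
  define k where "k = Max F"
  have F: "finite F" "F \<noteq> {}" using \<open>1 \<in> F\<close> by (auto simp: F_def)
  then have kF: "k \<in> F" unfolding k_def by (rule Max_in)
  have k1: "1 \<le> k" "k \<le> m" using kF by (auto simp: F_def)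
  have tm: "t_min P w c = comm_time w c m" by (simp add: t_min_def m_def)
  show ?thesis
  proof (cases "k = m")
    case True
    then show ?thesis using best[OF kF] t_min_pos[of w c P] assms unfolding tm by auto
  next
    case False
    \<comment> \<open>As \<open>k < m\<close>, only its area can bar \<open>Suc k\<close> from
      \<open>F\<close>.\<close>
    then have "Suc k \<notin> F" using F(1) Max_ge[of F "Suc k"] unfolding k_def by linarith
    then have u: "w < 3 * c * (real k * real (Suc k))"
      using k1 False by (auto simp: F_def mult_ac)
    have Q: "(8 * real k + 7) * m \<le> 9 * (real k * real (Suc k)) + 3 * real m * real m"
      using k1 by (rule_tac allocation_quadratic)
    let ?D = "real k * real (Suc k)"
    have D: "?D > 0" and k0: "real k > 0" and m0: "real m > 0" using k1 m1 by auto
    \<comment> \<open>The coefficient of \<open>c\<close> in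
      \<open>3 / 2 * comm_time w c m - comm_time w c k\<close> is nonnegative because
      \<open>k \<le> m\<close>, so \<open>c\<close> may be lowered to
      \<open>w / (3 * ?D)\<close>.\<close>
    have "comm_time w c k + (w / (3 * ?D)) * (3 / 2 * (real m - 1) - (real k - 1))
      \<le> w / real k + 3 / 2 * c * (real m - 1)"
    proof -
      have "w \<le> c * (3 * ?D)" using u by (simp add: algebra_simps)
      moreover have "0 < 3 * ?D" using D by linarith
      ultimately have "w / (3 * ?D) \<le> c" by (simp only: pos_divide_le_eq)
      then have "(w / (3 * ?D)) * (3 / 2 * (real m - 1) - (real k - 1))
        \<le> c * (3 / 2 * (real m - 1) - (real k - 1))"
        using k1 by (intro mult_right_mono) auto
      then show ?thesis by (simp add: comm_time_def algebra_simps)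
    qed
    moreover have "w / real k \<le> 3 / 2 * w / real m
        + (w / (3 * ?D)) * (3 / 2 * (real m - 1) - (real k - 1))"
    proof -
      \<comment> \<open>Over the common denominator \<open>6 * ?D * m\<close> the difference of the
        two sides is \<open>w\<close> times the slack of
        \<open>allocation_quadratic\<close>.\<close>
      have "0 \<le> w * (9 * ?D + 3 * real m * real m - (8 * real k + 7) * m) / (6 * ?D * real m)"
        using Q assms D m0 by (intro divide_nonneg_nonneg mult_nonneg_nonneg) auto
      also have "\<dots> = 3 / 2 * w / real m
        + (w / (3 * ?D)) * (3 / 2 * (real m - 1) - (real k - 1)) - w / real k"
        using k0 m0 by (simp add: divide_simps) (simp add: algebra_simps)
      finally show ?thesis by simp
    qed
    ultimately have "comm_time w c k \<le> 3 / 2 * w / real m + 3 / 2 * c * (real m - 1)"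
      by linarith
    also have "\<dots> = 3 / 2 * t_min P w c"
      unfolding tm by (simp add: comm_time_def distrib_left)
    finally have "comm_time w c k \<le> 3 / 2 * t_min P w c" .
    then show ?thesis using best[OF kF] by simp
  qed
qed

text \<open>Step 2 only lowers the allocation, so the area stays within its budget. The hypothesis
  \<open>3 / 2 \<le> 1 / \<mu>\<close> makes the weight of the work term nonnegative.\<close>

lemma final_allocation_bounds:
  assumes "w > 0" "c \<ge> 0" "P \<ge> 1" "0 < \<mu>" "\<mu> < 1"
    and init: "initial_allocation P (4 / 3) w c p" and p': "p' = final_allocation P \<mu> p"
  shows "1 \<le> p'" "p' \<le> P" "real p' < \<mu> * P + 1"
    "real p' * comm_time w c p' \<le> 4 / 3 * w"
    "3 / 2 \<le> 1 / \<mu> \<Longrightarrow> comm_time w c p' \<le> 3 / 2 * t_min P w c + (1 / \<mu> - 3 / 2) * w / P"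
proof -
  define q where "q = nat \<lceil>\<mu> * real P\<rceil>"
  have pp: "p' = min p q" by (simp add: p' q_def final_allocation_def)
  have P: "real P > 0" using assms by simp
  then have "\<mu> * P > 0" using assms by simp
  then have q: "\<mu> * P \<le> q" "q < \<mu> * P + 1" "1 \<le> q" unfolding q_def by linarith+
  have p: "1 \<le> p" "p \<le> p_max P w c" "comm_area w c p / a_min w c \<le> 4 / 3"
    using init by (auto simp: initial_allocation_def is_arg_min_def)
  have m: "p_max P w c \<le> P" using assms p_max_bounds by auto
  show p'1: "1 \<le> p'" using p q pp by simp
  show "p' \<le> P" using p m pp by simp
  show "real p' < \<mu> * P + 1" using q pp by (simp add: min_def)
  have "comm_area w c p' \<le> comm_area w c p" using p'1 assms pp by (intro comm_area_mono) auto
  also have "\<dots> \<le> 4 / 3 * w"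
    using p assms by (simp add: a_min_def comm_area_eq divide_simps)
  finally show "real p' * comm_time w c p' \<le> 4 / 3 * w" by (simp add: comm_area_def)
  assume mu: "3 / 2 \<le> 1 / \<mu>"
  show "comm_time w c p' \<le> 3 / 2 * t_min P w c + (1 / \<mu> - 3 / 2) * w / P"
  proof (cases "p \<le> q")
    case True
    moreover have "0 \<le> (1 / \<mu> - 3 / 2) * w / P" using mu assms by simp
    ultimately show ?thesis using initial_allocation_time[OF assms(1-3) init] pp by simp
  next
    case False
    define m where "m = p_max P w c"
    have qm: "q \<le> m" "m \<le> P" "p' = q" using False p m pp by (auto simp: m_def)
    \<comment> \<open>Of the \<open>1 / \<mu>\<close> copies of \<open>w / P\<close>,
      \<open>3 / 2\<close> are raised to \<open>w / m\<close> to match the work part of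
      \<open>t_min\<close>; the rest stays as the work term.\<close>
    have "w / q \<le> w / (\<mu> * P)" using q assms(1,4) P by (intro divide_left_mono mult_pos_pos) linarith+
    also have "\<dots> = 3 / 2 * (w / P) + (1 / \<mu> - 3 / 2) * w / P"
      using assms by (simp add: divide_simps) (simp add: algebra_simps)
    also have "w / P \<le> w / m" using qm q assms by (intro divide_left_mono) auto
    finally have "w / q \<le> 3 / 2 * (w / m) + (1 / \<mu> - 3 / 2) * w / P" by simp
    moreover have "c * (real q - 1) \<le> 3 / 2 * (c * (real m - 1))"
    proof -
      have "c * (real q - 1) \<le> c * (real m - 1)" using qm assms by (intro mult_left_mono) auto
      moreover have "0 \<le> c * (real m - 1)" using qm q assms by (intro mult_nonneg_nonneg) auto
      ultimately show ?thesis by simp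
    qed
    ultimately show ?thesis
      unfolding t_min_def m_def[symmetric] qm(3) comm_time_def by (simp add: distrib_left)
  qed
qed

section \<open>Invariants of a list scheduling run\<close>

text \<open>A rejected task exceeds the idle count when it is scanned, and that count only shrinks
  afterwards, so the task still does not fit when the pass ends. The multiset equation carries
  distinctness over to both lists.\<close>

lemma scan_properties:
  assumes "scan p f Q = (S, R)"
  shows "mset Q = mset S + mset R" "sum_list (map p S) \<le> f"
    "j \<in> set R \<Longrightarrow> f < sum_list (map p S) + p j"
proof -
  have "mset Q = mset S + mset R \<and> sum_list (map p S) \<le> f \<and>
    (\<forall>j\<in>set R. f < sum_list (map p S) + p j)"
    using assms
  proof (induction Q arbitrary: f S R)
    case (Cons i Q)
    show ?case
    proof (cases "p i \<le> f")
      case True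
      obtain S' R' where s: "scan p (f - p i) Q = (S', R')" by fastforce
      then show ?thesis using Cons.IH[OF s] Cons.prems True by force
    next
      case False
      obtain S' R' where s: "scan p f Q = (S', R')" by fastforce
      then show ?thesis using Cons.IH[OF s] Cons.prems False by force
    qed
  qed simp
  then show "mset Q = mset S + mset R" "sum_list (map p S) \<le> f"
    "j \<in> set R \<Longrightarrow> f < sum_list (map p S) + p j" by auto
qed

text \<open>An abstract setting for the run: the communication model enters it only through positive
  times and allocations between 1 and \<open>P\<close>.\<close>

locale list_schedule =
  fixes P :: nat and V :: "'a set" and E :: "('a \<times> 'a) set"
    and t :: "'a \<Rightarrow> nat \<Rightarrow> real" and p :: "'a \<Rightarrow> nat"
  assumes finite_V: "finite V" and E_subset: "E \<subseteq> V \<times> V" and acyclic_E: "acyclic E"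
    and time_pos: "j \<in> V \<Longrightarrow> 0 < t j (p j)"
    and alloc_ge_1: "j \<in> V \<Longrightarrow> 1 \<le> p j" and alloc_le: "j \<in> V \<Longrightarrow> p j \<le> P"
begin

lemma wf_E: "wf E"
  using finite_V E_subset acyclic_E finite_acyclic_wf finite_subset by blast

text \<open>Unlike \<open>running\<close>, this reads a start map at arbitrary instants, also past
  ones; hence the test \<open>s \<le> \<tau>\<close>.\<close>

definition active :: "('a \<rightharpoonup> real) \<Rightarrow> real \<Rightarrow> 'a set" where
  "active st \<tau> = {j. \<exists>s. st j = Some s \<and> s \<le> \<tau> \<and> \<tau> < s + t j (p j)}"

definition usage :: "('a \<rightharpoonup> real) \<Rightarrow> real \<Rightarrow> nat" where
  "usage st \<tau> = (\<Sum>j\<in>active st \<tau>. p j)"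

definition ready :: "('a \<rightharpoonup> real) \<Rightarrow> real \<Rightarrow> 'a \<Rightarrow> bool" where
  "ready st \<tau> j \<longleftrightarrow> (\<forall>i. (i, j) \<in> E \<longrightarrow> i \<in> completed t p st \<tau>)"

text \<open>Read off the start map rather than the queue, so that it makes sense between events and
  for past instants. Tasks without a start time count as well.\<close>

definition waiting :: "('a \<rightharpoonup> real) \<Rightarrow> real \<Rightarrow> 'a set" where
  "waiting st \<tau> = {j \<in> V. ready st \<tau> j \<and> (\<forall>s. st j = Some s \<longrightarrow> \<tau> < s)}"

definition consistent :: "'a list \<Rightarrow> ('a \<rightharpoonup> real) \<Rightarrow> bool" where
  "consistent Q st \<longleftrightarrow> dom st \<subseteq> V \<and> set Q \<subseteq> V \<and> distinct Q \<and> set Q \<inter> dom st = {} \<and>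
     (\<forall>j s. st j = Some s \<longrightarrow> 0 \<le> s \<and> ready st s j) \<and> (\<forall>\<tau>. usage st \<tau> \<le> P)"

definition saturated_on :: "real set \<Rightarrow> ('a \<rightharpoonup> real) \<Rightarrow> bool" where
  "saturated_on I st \<longleftrightarrow> (\<forall>\<tau>\<in>I. \<forall>j\<in>waiting st \<tau>. P < usage st \<tau> + p j)"

text \<open>This invariant and the next differ in whether the instant \<open>\<tau>\<close> is
  settled: here saturation is known on a half-open interval and all starts lie strictly before
  \<open>\<tau>\<close>.\<close>

definition before_event :: "real \<Rightarrow> 'a list \<Rightarrow> ('a \<rightharpoonup> real) \<Rightarrow> bool" where
  "before_event \<tau> Q st \<longleftrightarrow> 0 \<le> \<tau> \<and> consistent Q st \<and> saturated_on {0..<\<tau>} st \<and>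
     (\<forall>j s. st j = Some s \<longrightarrow> s < \<tau>) \<and> (\<forall>j\<in>set Q. ready st \<tau> j)"

definition after_event :: "real \<Rightarrow> 'a list \<Rightarrow> ('a \<rightharpoonup> real) \<Rightarrow> bool" where
  "after_event \<tau> Q st \<longleftrightarrow> 0 \<le> \<tau> \<and> consistent Q st \<and> saturated_on {0..\<tau>} st \<and>
     (\<forall>j s. st j = Some s \<longrightarrow> s \<le> \<tau>) \<and> (\<forall>j\<in>set Q. ready st \<tau> j)"

lemma active_eq_running:
  assumes "\<And>j s. st j = Some s \<Longrightarrow> s \<le> \<tau>"
  shows "active st \<tau> = running t p st \<tau>"
  using assms unfolding active_def running_def by blast

lemma finite_active: "dom st \<subseteq> V \<Longrightarrow> finite (active st \<tau>)"
  by (rule finite_subset[OF _ finite_V]) (auto simp: active_def)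

text \<open>Starting tasks at \<open>\<tau>\<close> leaves the history before \<open>\<tau>\<close>
  unchanged, so saturation and capacity have to be checked afresh only at \<open>\<tau>\<close>,
  where the scan provides them.\<close>

lemma process_event_after:
  assumes pre: "before_event \<tau> Q st" and ev: "process_event P V E t p \<tau> Q st Q' st'"
  shows "after_event \<tau> Q' st'"
proof -
  from ev obtain new queue S where
    new: "distinct new" "set new = newly_available V E t p Q st \<tau>"
    and queue: "queue \<in> shuffles Q new"
    and scan: "scan p (P - (\<Sum>j\<in>running t p st \<tau>. p j)) queue = (S, Q')"
    and st': "st' = (\<lambda>j. if j \<in> set S then Some \<tau> else st j)"
    unfolding process_event_def by blast
  have con: "consistent Q st" and sat: "saturated_on {0..<\<tau>} st" and \<tau>: "0 \<le> \<tau>"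
    and lt: "\<And>j s. st j = Some s \<Longrightarrow> s < \<tau>" and Qready: "\<And>j. j \<in> set Q \<Longrightarrow> ready st \<tau> j"
    using pre by (auto simp: before_event_def)
  have domV: "dom st \<subseteq> V" and QV: "set Q \<subseteq> V" "distinct Q" "set Q \<inter> dom st = {}"
    and started: "\<And>j s. st j = Some s \<Longrightarrow> 0 \<le> s \<and> ready st s j"
    and use: "\<And>\<tau>. usage st \<tau> \<le> P"
    using con by (auto simp: consistent_def)
  have newp: "set new \<subseteq> V" "set new \<inter> set Q = {}" "set new \<inter> dom st = {}"
      "\<And>j. j \<in> set new \<Longrightarrow> ready st \<tau> j"
    unfolding new(2) newly_available_def ready_def by auto
  have sq: "set queue = set Q \<union> set new" using queue by (rule set_shuffles)
  have dq: "distinct queue"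
    using distinct_disjoint_shuffles[OF QV(2) new(1) _ queue] newp by blast
  have ms: "mset queue = mset S + mset Q'" using scan_properties(1)[OF scan] .
  have "mset queue = mset (S @ Q')" using ms by simp
  then have sS: "set queue = set S \<union> set Q'" and dS: "distinct S" "distinct Q'" "set S \<inter> set Q' = {}"
    using dq mset_eq_setD[of queue "S @ Q'"] mset_eq_imp_distinct_iff[of queue "S @ Q'"] by auto
  have SV: "set S \<subseteq> V" and Sdom: "set S \<inter> dom st = {}" using sS sq QV newp by blast+
  have le: "s \<le> \<tau>" if "st' j = Some s" for j s
    using that lt[of j s] by (auto simp: st' split: if_splits)
  \<comment> \<open>Positive times keep a task started at \<open>\<tau>\<close> from being completed
    at \<open>\<tau>\<close>.\<close>
  have comp: "completed t p st' \<tau>' = completed t p st \<tau>'" if "\<tau>' \<le> \<tau>" for \<tau>'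
  proof -
    have "j \<in> completed t p st' \<tau>' \<longleftrightarrow> j \<in> completed t p st \<tau>'" for j
    proof (cases "j \<in> set S")
      case True
      then have "0 < t j (p j)" using SV time_pos by blast
      then have "\<not> \<tau> + t j (p j) \<le> \<tau>'" using that by linarith
      moreover have "st j = None" using True Sdom by auto
      ultimately show ?thesis using True by (auto simp: completed_def st')
    qed (simp add: completed_def st')
    then show ?thesis by blast
  qed
  then have ready': "ready st' \<tau>' j \<longleftrightarrow> ready st \<tau>' j" if "\<tau>' \<le> \<tau>" for \<tau>' j
    using that by (simp add: ready_def)
  have act_lt: "active st' \<tau>' = active st \<tau>'" if "\<tau>' < \<tau>" for \<tau>'
    using that Sdom by (auto simp: active_def st' split: if_splits)
  have act_eq: "active st' \<tau> = active st \<tau> \<union> set S"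
    using Sdom SV time_pos by (auto simp: active_def st' split: if_splits)
  \<comment> \<open>No start lies beyond \<open>\<tau>\<close>, so usage can only fall
    afterwards.\<close>
  have act_gt: "active st' \<tau>' \<subseteq> active st' \<tau>" if "\<tau>' > \<tau>" for \<tau>'
    using that le by (fastforce simp: active_def)
  have dom_eq: "dom st' = dom st \<union> set S" by (auto simp: st' split: if_splits)
  have dom': "dom st' \<subseteq> V" using domV SV dom_eq by blast
  have run: "running t p st \<tau> = active st \<tau>" using lt by (intro active_eq_running[symmetric]) fastforce
  have sumS: "sum_list (map p S) = (\<Sum>j\<in>set S. p j)" using dS by (simp add: sum_list_distinct_conv_sum_set)
  have us_eq: "usage st' \<tau> = usage st \<tau> + (\<Sum>j\<in>set S. p j)"
    unfolding usage_def act_eq using Sdom finite_active[OF domV]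
    by (intro sum.union_disjoint) (auto simp: active_def)
  have us_le: "usage st' \<tau> \<le> P"
    using scan_properties(2)[OF scan] use[of \<tau>] unfolding us_eq run sumS usage_def[symmetric] by linarith
  have use': "usage st' \<tau>' \<le> P" for \<tau>'
  proof (cases \<tau>' \<tau> rule: linorder_cases)
    case less then show ?thesis using use act_lt by (simp add: usage_def)
  next
    case greater
    then have "usage st' \<tau>' \<le> usage st' \<tau>"
      unfolding usage_def by (intro sum_mono2 finite_active dom' act_gt) auto
    then show ?thesis using us_le by simp
  qed (use us_le in simp)
  have Q'ready: "ready st' \<tau> j" if "j \<in> set Q'" for j
  proof -
    have "j \<in> set Q \<or> j \<in> set new" using that sS sq by blast
    then show ?thesis using Qready newp(4) ready' by auto
  qed
  have con': "consistent Q' st'"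
    unfolding consistent_def
  proof (intro conjI allI impI)
    show "set Q' \<inter> dom st' = {}" using dS sS sq QV newp unfolding dom_eq by blast
    fix j s assume j: "st' j = Some s"
    have "0 \<le> s \<and> ready st s j"
    proof (cases "j \<in> set S")
      case True
      then have "j \<in> set Q \<or> j \<in> set new" using sS sq by blast
      then show ?thesis using j True \<tau> Qready newp(4) by (auto simp: st')
    qed (use j started in \<open>auto simp: st'\<close>)
    then show "0 \<le> s" "ready st' s j" using ready' le[OF j] by auto
  qed (use dom' sS sq QV newp dS use' in auto)
  have sat': "saturated_on {0..\<tau>} st'"
    unfolding saturated_on_def
  proof (intro ballI)
    fix \<tau>' j assume \<tau>': "\<tau>' \<in> {0..\<tau>}" and j: "j \<in> waiting st' \<tau>'"
    show "P < usage st' \<tau>' + p j"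
    proof (cases "\<tau>' < \<tau>")
      case True
      have "st j = Some s \<Longrightarrow> \<tau>' < s" for s using j Sdom by (auto simp: waiting_def st' split: if_splits)
      then have "j \<in> waiting st \<tau>'" using j ready' \<tau>' by (auto simp: waiting_def)
      then have "P < usage st \<tau>' + p j" using sat True \<tau>' by (auto simp: saturated_on_def)
      then show ?thesis using act_lt[OF True] by (simp add: usage_def)
    next
      case False
      then have eq: "\<tau>' = \<tau>" using \<tau>' by simp
      \<comment> \<open>All recorded starts are at most \<open>\<tau>\<close>, so a task waiting at
        \<open>\<tau>\<close> is unstarted; being ready it was in the queue, hence the scan rejected
        it.\<close>
      have "j \<notin> dom st'" using j le by (fastforce simp: waiting_def eq)
      then have nS: "j \<notin> set S" "j \<notin> dom st" by (auto simp: st' split: if_splits)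
      have "ready st \<tau> j" "j \<in> V" using j ready' by (auto simp: waiting_def eq)
      then have "j \<in> set queue" using nS sq new(2) by (auto simp: newly_available_def ready_def)
      then have "j \<in> set Q'" using nS sS by auto
      then show ?thesis
        using scan_properties(3)[OF scan] unfolding eq us_eq run sumS usage_def[symmetric] by fastforce
    qed
  qed
  show ?thesis using con' sat' \<tau> le Q'ready by (auto simp: after_event_def)
qed

lemma before_start: "before_event 0 [] Map.empty"
  by (auto simp: before_event_def consistent_def saturated_on_def usage_def active_def)

lemma finite_running: "dom st \<subseteq> V \<Longrightarrow> finite (running t p st \<tau>)"
  by (rule finite_subset[OF _ finite_V]) (auto simp: running_def)

lemma next_completion_greater:
  assumes "dom st \<subseteq> V" "running t p st \<tau> \<noteq> {}"
  shows "\<tau> < next_completion t p st \<tau>"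
  unfolding next_completion_def using assms finite_running[of st \<tau>]
  by (subst Min_gr_iff) (auto simp: running_def)

lemma next_completion_le:
  assumes "dom st \<subseteq> V" "st j = Some s" "\<tau> < s + t j (p j)"
  shows "next_completion t p st \<tau> \<le> s + t j (p j)"
proof -
  have "j \<in> running t p st \<tau>" using assms by (simp add: running_def)
  then have "next_completion t p st \<tau> \<le> the (st j) + t j (p j)"
    unfolding next_completion_def using finite_running[of st \<tau>] assms by (intro Min_le imageI) auto
  then show ?thesis using assms by simp
qed

text \<open>Between two events nothing starts or completes, so the situation at
  \<open>\<tau>\<close> persists until just before the next completion.\<close>

lemma before_next_completion:
  assumes "after_event \<tau> Q st" "running t p st \<tau> \<noteq> {}"
  shows "before_event (next_completion t p st \<tau>) Q st"
proof -
  let ?n = "next_completion t p st \<tau>"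
  have con: "consistent Q st" and sat: "saturated_on {0..\<tau>} st" and \<tau>: "0 \<le> \<tau>"
    and le: "\<And>j s. st j = Some s \<Longrightarrow> s \<le> \<tau>" and Qready: "\<And>j. j \<in> set Q \<Longrightarrow> ready st \<tau> j"
    using assms by (auto simp: after_event_def)
  have domV: "dom st \<subseteq> V" using con by (simp add: consistent_def)
  have gt: "\<tau> < ?n" using next_completion_greater[OF domV assms(2)] .
  have comp: "completed t p st \<tau>' = completed t p st \<tau>" if "\<tau> \<le> \<tau>'" "\<tau>' < ?n" for \<tau>'
    using that next_completion_le[OF domV, of _ _ \<tau>] by (fastforce simp: completed_def)
  have act: "active st \<tau>' = active st \<tau>" if "\<tau> \<le> \<tau>'" "\<tau>' < ?n" for \<tau>'
    using that next_completion_le[OF domV, of _ _ \<tau>] le by (fastforce simp: active_def)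
  have "P < usage st \<tau>' + p j" if "0 \<le> \<tau>'" "\<tau>' < ?n" "j \<in> waiting st \<tau>'" for \<tau>' j
  proof (cases "\<tau>' \<le> \<tau>")
    case True then show ?thesis using sat that by (auto simp: saturated_on_def)
  next
    case False
    then have "j \<in> waiting st \<tau>" using that comp[of \<tau>'] by (fastforce simp: waiting_def ready_def)
    then have "P < usage st \<tau> + p j" using sat \<tau> by (auto simp: saturated_on_def)
    then show ?thesis using act[of \<tau>'] False that by (simp add: usage_def)
  qed
  moreover have "ready st ?n j" if "j \<in> set Q" for j
    using Qready[OF that] gt by (fastforce simp: ready_def completed_def)
  moreover have "s < ?n" if "st j = Some s" for j s using le[OF that] gt by simp
  ultimately show ?thesis using con \<tau> gt by (auto simp: before_event_def saturated_on_def)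
qed

lemma after_event_reachable:
  "list_scheduling P V E t p \<tau> Q st \<Longrightarrow> after_event \<tau> Q st"
  by (induction rule: list_scheduling.induct)
    (auto intro: process_event_after before_start before_next_completion)

text \<open>An \<open>E\<close>-minimal unstarted task would be ready on an idle machine, and
  saturation would then force \<open>p j > P\<close>.\<close>

lemma all_tasks_started:
  assumes "after_event \<tau> Q st" "running t p st \<tau> = {}"
  shows "dom st = V"
proof (rule ccontr)
  assume "dom st \<noteq> V"
  moreover have domV: "dom st \<subseteq> V" using assms by (simp add: after_event_def consistent_def)
  ultimately obtain j0 where "j0 \<in> V - dom st" by blast
  with wf_E obtain j where j: "j \<in> V - dom st" and min: "\<And>i. (i, j) \<in> E \<Longrightarrow> i \<notin> V - dom st"
    by (rule wfE_min) blast
  have finished: "i \<in> completed t p st \<tau>" if "i \<in> dom st" for i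
    using that assms(2) by (fastforce simp: completed_def running_def)
  have "ready st \<tau> j" using min E_subset finished by (auto simp: ready_def)
  then have "j \<in> waiting st \<tau>" using j by (auto simp: waiting_def)
  then have "P < usage st \<tau> + p j" using assms(1) by (auto simp: after_event_def saturated_on_def)
  moreover have "usage st \<tau> = 0"
    using assms active_eq_running[of st \<tau>] by (simp add: after_event_def usage_def)
  ultimately show False using alloc_le[of j] j by simp
qed

lemma process_event_exists:
  "\<exists>Q' st'. process_event P V E t p \<tau> Q st Q' st'"
proof -
  have "finite (newly_available V E t p Q st \<tau>)"
    using finite_V by (simp add: newly_available_def)
  then obtain new where "distinct new" "set new = newly_available V E t p Q st \<tau>"
    using finite_distinct_list by metis
  moreover have "Q @ new \<in> shuffles Q new" by (induction Q) (auto simp: Cons_in_shuffles_iff)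
  moreover obtain S Q' where "scan p (P - (\<Sum>j\<in>running t p st \<tau>. p j)) (Q @ new) = (S, Q')"
    by fastforce
  ultimately show ?thesis unfolding process_event_def by blast
qed

text \<open>Each event completes the task whose end defines it, so the number of uncompleted tasks
  drops.\<close>

lemma run_terminates:
  assumes "list_scheduling P V E t p \<tau> Q st"
  shows "\<exists>\<tau> Q st. list_scheduling P V E t p \<tau> Q st \<and> running t p st \<tau> = {}"
  using assms
proof (induction "card (V - completed t p st \<tau>)" arbitrary: \<tau> Q st rule: less_induct)
  case less
  show ?case
  proof (cases "running t p st \<tau> = {}")
    case False
    define n where "n = next_completion t p st \<tau>"
    obtain Q' st' where ev: "process_event P V E t p n Q st Q' st'"
      using process_event_exists by blast
    have ls: "list_scheduling P V E t p n Q' st'"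
      using list_scheduling.completion[OF less.prems False n_def ev] .
    have after: "after_event \<tau> Q st" using after_event_reachable[OF less.prems] .
    have domV: "dom st \<subseteq> V" and disj: "set Q \<inter> dom st = {}"
      using after by (auto simp: after_event_def consistent_def)
    have gt: "\<tau> < n" unfolding n_def using next_completion_greater[OF domV False] .
    have "n \<in> (\<lambda>j. the (st j) + t j (p j)) ` running t p st \<tau>"
      unfolding n_def next_completion_def using finite_running[OF domV] False by (intro Min_in) auto
    then obtain i s where i: "st i = Some s" "\<tau> < s + t i (p i)" "n = s + t i (p i)"
      by (auto simp: running_def)
    \<comment> \<open>Start times are never overwritten: the scan starts only queued tasks, and
      those have no start time.\<close>
    have keep: "st' j = Some r" if "st j = Some r" for j r
    proof -
      obtain new queue S f where *: "set new = newly_available V E t p Q st n"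
        "queue \<in> shuffles Q new" "scan p f queue = (S, Q')"
        "st' = (\<lambda>j. if j \<in> set S then Some n else st j)"
        using ev unfolding process_event_def by blast
      have "set S \<subseteq> set queue" using scan_properties(1)[OF *(3)] by (metis mset_subset_eq_add_left set_mset_mono set_mset_mset)
      then have "j \<notin> set S"
        using that disj set_shuffles[OF *(2)] *(1) by (auto simp: newly_available_def)
      then show ?thesis using that *(4) by simp
    qed
    have "completed t p st \<tau> \<subseteq> completed t p st' n"
      using keep gt by (fastforce simp: completed_def)
    moreover have "i \<in> completed t p st' n" "i \<in> V" "i \<notin> completed t p st \<tau>"
      using i keep domV by (auto simp: completed_def)
    ultimately have "V - completed t p st' n \<subset> V - completed t p st \<tau>" by blast
    then have "card (V - completed t p st' n) < card (V - completed t p st \<tau>)"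
      using finite_V by (intro psubset_card_mono) auto
    then show ?thesis using less.hyps ls by blast
  qed (use less.prems in blast)
qed

lemma terminating_run_exists:
  "\<exists>\<tau> Q st. list_scheduling P V E t p \<tau> Q st \<and> running t p st \<tau> = {}"
proof -
  obtain Q st where "process_event P V E t p 0 [] Map.empty Q st"
    using process_event_exists by blast
  then show ?thesis by (rule run_terminates[OF list_scheduling.start])
qed

end

section \<open>The finished run and its critical chain\<close>

context list_schedule
begin

text \<open>Translates the invariants at the end of a run into statements about a total start
  function, the form in which the run is used from here on.\<close>

lemma output_dom_feasible_saturated:
  assumes run: "list_scheduling P V E t p \<tau> Q st" "running t p st \<tau> = {}"
  defines "\<sigma> \<equiv> \<lambda>j. the (st j)"
  shows "dom st = V" "feasible_schedule P V E t p \<sigma>"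
    "\<And>j x. j \<in> V \<Longrightarrow> 0 \<le> x \<Longrightarrow> x < \<sigma> j \<Longrightarrow> (\<And>i. (i, j) \<in> E \<Longrightarrow> \<sigma> i + t i (p i) \<le> x) \<Longrightarrow>
       P < (\<Sum>j | j \<in> V \<and> \<sigma> j \<le> x \<and> x < \<sigma> j + t j (p j). p j) + p j"
proof -
  have after: "after_event \<tau> Q st" using after_event_reachable[OF run(1)] .
  show dom: "dom st = V" using all_tasks_started[OF after run(2)] .
  have st: "st j = Some (\<sigma> j)" if "j \<in> V" for j
    using that domIff[of j st] unfolding dom \<sigma>_def by simp
  have inV: "j \<in> V" if "st j = Some s" for j s using that dom by auto
  have act: "active st x = {j \<in> V. \<sigma> j \<le> x \<and> x < \<sigma> j + t j (p j)}" for x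
  proof -
    have "j \<in> active st x \<longleftrightarrow> j \<in> V \<and> \<sigma> j \<le> x \<and> x < \<sigma> j + t j (p j)" for j
      using st[of j] inV[of j] by (cases "j \<in> V") (auto simp: active_def)
    then show ?thesis by blast
  qed
  have con: "consistent Q st" and sat: "saturated_on {0..\<tau>} st"
    and le: "\<And>j. j \<in> V \<Longrightarrow> \<sigma> j \<le> \<tau>"
    using after st unfolding after_event_def by blast+
  have comp: "i \<in> completed t p st x \<longleftrightarrow> \<sigma> i + t i (p i) \<le> x" if "i \<in> V" for i x
    using st[OF that] by (simp add: completed_def)
  have ready: "0 \<le> \<sigma> j \<and> ready st (\<sigma> j) j" if "j \<in> V" for j
    using con st[OF that] unfolding consistent_def by blast
  show "feasible_schedule P V E t p \<sigma>"
    unfolding feasible_schedule_def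
  proof (intro conjI ballI allI)
    fix e assume "e \<in> E"
    moreover obtain i j where e: "e = (i, j)" by fastforce
    ultimately have ij: "(i, j) \<in> E" "i \<in> V" "j \<in> V" using E_subset by auto
    then have "i \<in> completed t p st (\<sigma> j)" using ready[of j] by (simp add: ready_def)
    then show "case e of (i, j) \<Rightarrow> \<sigma> i + t i (p i) \<le> \<sigma> j"
      using comp ij by (simp add: e)
  next
    fix x
    show "(\<Sum>j | j \<in> V \<and> \<sigma> j \<le> x \<and> x < \<sigma> j + t j (p j). p j) \<le> P"
      using con unfolding act[symmetric] by (simp add: consistent_def usage_def)
  next
    fix j assume "j \<in> V"
    then show "p j \<in> {1..P}" "0 \<le> \<sigma> j" using alloc_ge_1 alloc_le ready by simp_all
  qed
  fix j x
  assume j: "j \<in> V" "0 \<le> x" "x < \<sigma> j" "\<And>i. (i, j) \<in> E \<Longrightarrow> \<sigma> i + t i (p i) \<le> x"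
  have "i \<in> completed t p st x" if "(i, j) \<in> E" for i using j(4)[OF that] comp[of i] that E_subset by blast
  then have "j \<in> waiting st x" using j(1,3) st[OF j(1)] by (simp add: waiting_def ready_def)
  moreover have "x \<in> {0..\<tau>}" using j le[of j] by simp
  ultimately have "P < usage st x + p j" using sat unfolding saturated_on_def by blast
  then show "P < (\<Sum>j | j \<in> V \<and> \<sigma> j \<le> x \<and> x < \<sigma> j + t j (p j). p j) + p j"
    by (simp add: usage_def act)
qed

end

text \<open>
  The chain is built backwards: below the latest completion \<open>r\<close> of a predecessor of \<open>j\<close> use the
  chain of that predecessor; from \<open>r\<close> on, \<open>j\<close> is waiting, then running.  Any other schedule
  \<open>(q, \<rho>)\<close> has to run the chain sequentially.
\<close>
lemma critical_chain:
  fixes \<sigma> \<rho> d m d' :: "'a \<Rightarrow> real"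
  assumes "finite V" "wf E" "E \<subseteq> V \<times> V"
    and busy: "\<And>j x. j \<in> V \<Longrightarrow> 0 \<le> x \<Longrightarrow> x < \<sigma> j \<Longrightarrow> (\<And>i. (i, j) \<in> E \<Longrightarrow> \<sigma> i + d i \<le> x) \<Longrightarrow> B x"
    and other: "\<And>i j. (i, j) \<in> E \<Longrightarrow> \<rho> i + d' i \<le> \<rho> j" "\<And>j. j \<in> V \<Longrightarrow> 0 \<le> \<rho> j"
    and m: "\<And>j. j \<in> V \<Longrightarrow> 0 \<le> m j" "\<And>j. j \<in> V \<Longrightarrow> m j \<le> d' j"
    and "j \<in> V"
  shows "\<exists>C\<subseteq>V. sum m C \<le> \<rho> j + d' j \<and>
    (\<forall>x. 0 \<le> x \<and> x < \<sigma> j + d j \<longrightarrow> B x \<or> (\<exists>i\<in>C. \<sigma> i \<le> x \<and> x < \<sigma> i + d i))"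
  using \<open>wf E\<close> \<open>j \<in> V\<close>
proof (induction j rule: wf_induct_rule)
  case (less j)
  \<comment> \<open>First cover only the time before \<open>j\<close> starts, within the budget
    \<open>\<rho> j\<close>; adding \<open>j\<close> itself then uses up
    \<open>d' j\<close>.\<close>
  have "\<exists>C\<subseteq>V. sum m C \<le> \<rho> j \<and>
    (\<forall>x. 0 \<le> x \<and> x < \<sigma> j \<longrightarrow> B x \<or> (\<exists>i\<in>C. \<sigma> i \<le> x \<and> x < \<sigma> i + d i))"
  proof (cases "\<exists>i. (i, j) \<in> E")
    case False
    then have "B x" if "0 \<le> x" "x < \<sigma> j" for x using busy[OF less.prems that] by blast
    then show ?thesis using other(2)[OF less.prems] by (intro exI[of _ "{}"]) simp
  next
    case True
    define N where "N = {i. (i, j) \<in> E}"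
    have N: "finite N" "N \<noteq> {}" "N \<subseteq> V"
      using True assms(1,3) by (auto simp: N_def intro: finite_subset[of _ V])
    let ?F = "(\<lambda>i. \<sigma> i + d i) ` N"
    have "Max ?F \<in> ?F" using N by (intro Max_in) auto
    then obtain i where "i \<in> N" "Max ?F = \<sigma> i + d i" by auto
    then have i: "i \<in> N" "\<And>k. k \<in> N \<Longrightarrow> \<sigma> k + d k \<le> \<sigma> i + d i"
      using Max_ge[of ?F] N(1) by fastforce+
    obtain C where C: "C \<subseteq> V" "sum m C \<le> \<rho> i + d' i"
      "\<And>x. 0 \<le> x \<Longrightarrow> x < \<sigma> i + d i \<Longrightarrow> B x \<or> (\<exists>i\<in>C. \<sigma> i \<le> x \<and> x < \<sigma> i + d i)"
      using less.IH[of i] i N unfolding N_def by blast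
    have "B x \<or> (\<exists>i\<in>C. \<sigma> i \<le> x \<and> x < \<sigma> i + d i)" if "0 \<le> x" "x < \<sigma> j" for x
    proof (cases "x < \<sigma> i + d i")
      case False
      then have "\<sigma> k + d k \<le> x" if "(k, j) \<in> E" for k using i(2)[of k] that by (simp add: N_def)
      then have "B x" using busy[OF less.prems that] by blast
      then show ?thesis ..
    qed (use C that in blast)
    moreover have "sum m C \<le> \<rho> j" using C other(1)[of i j] i by (simp add: N_def)
    ultimately show ?thesis using C(1) by blast
  qed
  then obtain C where C: "C \<subseteq> V" "sum m C \<le> \<rho> j"
    "\<And>x. 0 \<le> x \<Longrightarrow> x < \<sigma> j \<Longrightarrow> B x \<or> (\<exists>i\<in>C. \<sigma> i \<le> x \<and> x < \<sigma> i + d i)" by blast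
  have "finite C" using C assms(1) finite_subset by blast
  \<comment> \<open>If \<open>j\<close> already lies in \<open>C\<close>, the sum does not change,
    and \<open>0 \<le> m j \<le> d' j\<close> suffices.\<close>
  then have "sum m (insert j C) \<le> \<rho> j + d' j"
    using C m[OF less.prems] by (cases "j \<in> C") (auto simp: insert_absorb)
  moreover have "B x \<or> (\<exists>i\<in>insert j C. \<sigma> i \<le> x \<and> x < \<sigma> i + d i)" if "0 \<le> x" "x < \<sigma> j + d j" for x
  proof (cases "x < \<sigma> j")
    case True then show ?thesis using C(3)[of x] that by blast
  qed (use that in auto)
  ultimately show ?case using C(1) less.prems by (intro exI[of _ "insert j C"]) blast
qed

section \<open>Integration over time and the charging argument\<close>

lemma has_integral_step:
  fixes a b M k :: real
  assumes "0 \<le> a" "a \<le> b" "b \<le> M"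
  shows "((\<lambda>x. if a \<le> x \<and> x < b then k else 0) has_integral k * (b - a)) {0..M}"
proof -
  have "((\<lambda>x. k) has_integral k * (b - a)) {a..b}"
    using has_integral_const_real[of k a b] assms by (simp add: mult.commute)
  then have "((\<lambda>x. if x \<in> {a..b} then k else 0) has_integral k * (b - a)) {0..M}"
    using assms by (subst has_integral_restrict) auto
  \<comment> \<open>The half-open interval, as in the schedules, differs from the closed one only at
    \<open>b\<close>.\<close>
  then show ?thesis
    by (rule has_integral_spike_finite[of "{b}", rotated 2]) auto
qed

text \<open>Exchanges sum and integral: each task contributes a step of height \<open>k j\<close>
  and length \<open>d j\<close>.\<close>

lemma has_integral_sum_steps:
  fixes \<sigma> d k :: "'a \<Rightarrow> real"
  assumes "finite A" "\<And>j. j \<in> A \<Longrightarrow> 0 \<le> \<sigma> j \<and> 0 \<le> d j \<and> \<sigma> j + d j \<le> M"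
  shows "((\<lambda>x. \<Sum>j | j \<in> A \<and> \<sigma> j \<le> x \<and> x < \<sigma> j + d j. k j) has_integral (\<Sum>j\<in>A. k j * d j)) {0..M}"
proof -
  have "((\<lambda>x. \<Sum>j\<in>A. if \<sigma> j \<le> x \<and> x < \<sigma> j + d j then k j else 0) has_integral (\<Sum>j\<in>A. k j * d j)) {0..M}"
    using has_integral_step[of "\<sigma> j" "\<sigma> j + d j" M "k j" for j] assms
    by (intro has_integral_sum) auto
  moreover have "(\<Sum>j\<in>A. if \<sigma> j \<le> x \<and> x < \<sigma> j + d j then k j else 0) =
      (\<Sum>j | j \<in> A \<and> \<sigma> j \<le> x \<and> x < \<sigma> j + d j. k j)" for x
    by (rule sum.inter_filter[OF assms(1), symmetric])
  ultimately show ?thesis by simp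
qed

lemma makespan_bounds:
  assumes "finite V"
  shows "0 \<le> makespan V t q \<sigma>" "j \<in> V \<Longrightarrow> \<sigma> j + t j (q j) \<le> makespan V t q \<sigma>"
    "makespan V t q \<sigma> = 0 \<or> (\<exists>j\<in>V. makespan V t q \<sigma> = \<sigma> j + t j (q j))"
proof -
  let ?X = "insert 0 ((\<lambda>j. \<sigma> j + t j (q j)) ` V)"
  have X: "finite ?X" "?X \<noteq> {}" using assms by auto
  show "0 \<le> makespan V t q \<sigma>" "j \<in> V \<Longrightarrow> \<sigma> j + t j (q j) \<le> makespan V t q \<sigma>"
    unfolding makespan_def using X by (auto intro!: Max_ge)
  show "makespan V t q \<sigma> = 0 \<or> (\<exists>j\<in>V. makespan V t q \<sigma> = \<sigma> j + t j (q j))"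
    using Max_in[OF X] unfolding makespan_def by auto
qed

text \<open>Integrate the capacity constraint over the whole schedule.\<close>

lemma total_area_le:
  assumes "finite V" "feasible_schedule P V E t q \<sigma>" "\<And>j. j \<in> V \<Longrightarrow> 0 \<le> t j (q j)"
  shows "(\<Sum>j\<in>V. real (q j) * t j (q j)) \<le> real P * makespan V t q \<sigma>"
proof -
  let ?M = "makespan V t q \<sigma>"
  have "((\<lambda>x. \<Sum>j | j \<in> V \<and> \<sigma> j \<le> x \<and> x < \<sigma> j + t j (q j). real (q j)) has_integral
      (\<Sum>j\<in>V. real (q j) * t j (q j))) {0..?M}"
    using assms makespan_bounds(2)[OF assms(1)]
    by (intro has_integral_sum_steps) (auto simp: feasible_schedule_def)
  moreover have "((\<lambda>x. real P) has_integral real P * ?M) {0..?M}"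
    using has_integral_const_real[of "real P" 0 ?M] makespan_bounds(1)[OF assms(1), of t q \<sigma>]
    by (simp add: mult.commute)
  moreover have "(\<Sum>j | j \<in> V \<and> \<sigma> j \<le> x \<and> x < \<sigma> j + t j (q j). real (q j)) \<le> real P" for x
    using assms(2) unfolding feasible_schedule_def of_nat_sum[symmetric] of_nat_le_iff by blast
  ultimately show ?thesis by (rule has_integral_le)
qed

text \<open>
  At each instant before the makespan the weights \<open>L m i / t i (p i)\<close> of the running tasks of a
  critical chain and \<open>K b j / t j (p j)\<close> of all running tasks sum up to at least 1; integrating
  over time gives the claim.
\<close>
lemma makespan_le_of_charging:
  fixes m b :: "'a \<Rightarrow> real"
  assumes "finite V" "wf E" "E \<subseteq> V \<times> V"
    and alg: "feasible_schedule P V E t p \<sigma>"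
    and busy: "\<And>j x. j \<in> V \<Longrightarrow> 0 \<le> x \<Longrightarrow> x < \<sigma> j \<Longrightarrow> (\<And>i. (i, j) \<in> E \<Longrightarrow> \<sigma> i + t i (p i) \<le> x) \<Longrightarrow>
       P < (\<Sum>j | j \<in> V \<and> \<sigma> j \<le> x \<and> x < \<sigma> j + t j (p j). p j) + p j"
    and other: "feasible_schedule P V E t q \<rho>"
    and tpos: "\<And>j. j \<in> V \<Longrightarrow> 0 < t j (p j)"
    and m: "\<And>j. j \<in> V \<Longrightarrow> 0 \<le> m j" "\<And>j. j \<in> V \<Longrightarrow> m j \<le> t j (q j)"
    and b: "\<And>j. j \<in> V \<Longrightarrow> 0 \<le> b j" "\<And>j. j \<in> V \<Longrightarrow> b j \<le> real (q j) * t j (q j) / P"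
    and coeff: "0 \<le> L" "0 \<le> K"
    and chain: "\<And>j. j \<in> V \<Longrightarrow> t j (p j) \<le> L * m j + K * b j"
    and alloc: "\<And>j. j \<in> V \<Longrightarrow> real (p j) < \<mu> * P + 1"
    and area: "\<And>j. j \<in> V \<Longrightarrow> real (p j) * t j (p j) \<le> (1 - \<mu>) * K * P * b j"
    and mu: "\<mu> < 1" and P: "P \<ge> 1"
  shows "makespan V t p \<sigma> \<le> (L + K) * makespan V t q \<rho>"
proof -
  let ?T = "makespan V t p \<sigma>" and ?M = "makespan V t q \<rho>"
  have M: "0 \<le> ?M" and end_le: "\<And>j. j \<in> V \<Longrightarrow> \<rho> j + t j (q j) \<le> ?M"
    using makespan_bounds[OF assms(1)] by blast+
  consider "?T = 0" | j where "j \<in> V" "?T = \<sigma> j + t j (p j)"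
    using makespan_bounds(3)[OF assms(1)] by blast
  then show ?thesis
  proof cases
    case 1
    then show ?thesis using M coeff by simp
  next
    case (2 j)
    define R where "R A x = {j \<in> A. \<sigma> j \<le> x \<and> x < \<sigma> j + t j (p j)}" for A x
    \<comment> \<open>Which task fails to fit is forgotten, as \<open>alloc\<close> bounds the size
      of every task.\<close>
    define B where "B x \<longleftrightarrow> (\<exists>j\<in>V. P < (\<Sum>j\<in>R V x. p j) + p j)" for x
    obtain C where C: "C \<subseteq> V" "sum m C \<le> \<rho> j + t j (q j)"
      and cov: "\<And>x. 0 \<le> x \<Longrightarrow> x < ?T \<Longrightarrow> B x \<or> (\<exists>i\<in>C. i \<in> R C x)"
    proof -
      have "\<exists>C\<subseteq>V. sum m C \<le> \<rho> j + t j (q j) \<and>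
        (\<forall>x. 0 \<le> x \<and> x < \<sigma> j + t j (p j) \<longrightarrow> B x \<or> (\<exists>i\<in>C. \<sigma> i \<le> x \<and> x < \<sigma> i + t i (p i)))"
      proof (rule critical_chain[OF assms(1-3) _ _ _ m 2(1)])
        fix j x
        assume "j \<in> V" "0 \<le> x" "x < \<sigma> j" "\<And>i. (i, j) \<in> E \<Longrightarrow> \<sigma> i + t i (p i) \<le> x"
        then show "B x" using busy[of j x] unfolding B_def R_def by blast
      qed (use other in \<open>auto simp: feasible_schedule_def\<close>)
      then show ?thesis using that 2(2) by (auto simp: R_def)
    qed
    have fC: "finite C" using C(1) assms(1) finite_subset by blast
    define g where "g x = (\<Sum>i\<in>R C x. L * m i / t i (p i)) + (\<Sum>i\<in>R V x. K * b i / t i (p i))" for x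
    have \<sigma>: "0 \<le> \<sigma> i \<and> 0 \<le> t i (p i) \<and> \<sigma> i + t i (p i) \<le> ?T" if "i \<in> V" for i
      using that alg tpos[of i] makespan_bounds(2)[OF assms(1)] by (auto simp: feasible_schedule_def)
    have "(g has_integral (\<Sum>i\<in>C. L * m i / t i (p i) * t i (p i)) +
        (\<Sum>i\<in>V. K * b i / t i (p i) * t i (p i))) {0..?T}"
      unfolding g_def R_def using C(1) fC assms(1) \<sigma>
      by (intro has_integral_add has_integral_sum_steps) auto
    moreover have "(\<Sum>i\<in>C. L * m i / t i (p i) * t i (p i)) = L * sum m C"
      unfolding sum_distrib_left
    proof (rule sum.cong)
      fix i assume "i \<in> C"
      then show "L * m i / t i (p i) * t i (p i) = L * m i" using C(1) tpos[of i] by auto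
    qed simp
    moreover have "(\<Sum>i\<in>V. K * b i / t i (p i) * t i (p i)) = K * sum b V"
      unfolding sum_distrib_left
    proof (rule sum.cong)
      fix i assume "i \<in> V"
      then show "K * b i / t i (p i) * t i (p i) = K * b i" using tpos[of i] by simp
    qed simp
    ultimately have gint: "(g has_integral L * sum m C + K * sum b V) {0..?T}" by simp
    have gterm: "0 \<le> L * m i / t i (p i)" "0 \<le> K * b i / t i (p i)" if "i \<in> V" for i
      using that m b coeff tpos[OF that] by auto
    have g0: "0 \<le> g x" for x
      unfolding g_def using gterm C(1) by (intro add_nonneg_nonneg sum_nonneg) (auto simp: R_def)
    have g1: "1 \<le> g x" if "0 \<le> x" "x < ?T" for x
      using cov[OF that]
    proof
      assume "B x"
      then obtain j where j: "j \<in> V" "P < (\<Sum>j\<in>R V x. p j) + p j" by (auto simp: B_def)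
      \<comment> \<open>The strict inequality between integers yields the \<open>- 1\<close> that
        cancels the \<open>+ 1\<close> in \<open>alloc\<close>.\<close>
      then have "real P \<le> (\<Sum>j\<in>R V x. real (p j)) + real (p j) - 1"
        unfolding of_nat_sum[symmetric] by linarith
      then have U: "(1 - \<mu>) * P \<le> (\<Sum>j\<in>R V x. real (p j))"
        using alloc[OF j(1)] by (simp add: algebra_simps)
      have pos: "(1 - \<mu>) * P > 0" using mu P by simp
      have "1 \<le> (\<Sum>i\<in>R V x. real (p i)) / ((1 - \<mu>) * P)" using U pos by simp
      also have "\<dots> = (\<Sum>i\<in>R V x. real (p i) / ((1 - \<mu>) * P))" by (rule sum_divide_distrib)
      \<comment> \<open>By \<open>area\<close>, each running task weighs at least
        \<open>p i / ((1 - \<mu>) * P)\<close>.\<close>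
      also have "\<dots> \<le> (\<Sum>i\<in>R V x. K * b i / t i (p i))"
      proof (rule sum_mono)
        fix i assume "i \<in> R V x"
        then have "i \<in> V" by (simp add: R_def)
        then show "real (p i) / ((1 - \<mu>) * P) \<le> K * b i / t i (p i)"
          using area[of i] tpos[of i] pos by (simp only: pos_divide_le_eq pos_le_divide_eq times_divide_eq_left) (simp add: mult_ac)
      qed
      also have "\<dots> \<le> g x"
        unfolding g_def using gterm C(1) by (auto simp: R_def intro!: sum_nonneg)
      finally show ?thesis .
    next
      assume "\<exists>i\<in>C. i \<in> R C x"
      then obtain i where i: "i \<in> R C x" "i \<in> R V x" "i \<in> V" using C(1) by (auto simp: R_def)
      have fin: "finite (R C x)" "finite (R V x)" using fC assms(1) by (auto simp: R_def)
      \<comment> \<open>A running chain task counts in both sums of \<open>g\<close>, and by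
        \<open>chain\<close> its two weights add up to at least 1.\<close>
      have "1 \<le> (L * m i + K * b i) / t i (p i)" using chain[OF i(3)] tpos[OF i(3)] by simp
      also have "\<dots> = L * m i / t i (p i) + K * b i / t i (p i)" by (rule add_divide_distrib)
      also have "\<dots> \<le> g x"
        unfolding g_def using i fin gterm C(1)
        by (intro add_mono member_le_sum) (auto simp: R_def)
      finally show ?thesis .
    qed
    \<comment> \<open>The makespan is the integral of a half-open indicator, so that at
      \<open>x = ?T\<close> only \<open>0 \<le> g x\<close> is asked for.\<close>
    have "((\<lambda>x. if 0 \<le> x \<and> x < ?T then 1 else 0) has_integral 1 * (?T - 0)) {0..?T}"
      using makespan_bounds(1)[OF assms(1)] by (intro has_integral_step) auto
    then have "1 * (?T - 0) \<le> L * sum m C + K * sum b V"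
      by (rule has_integral_le[OF _ gint]) (use g0 g1 in auto)
    moreover have "sum m C \<le> ?M" using C(2) end_le[OF 2(1)] by simp
    moreover have "sum b V \<le> ?M"
    proof -
      have "sum b V \<le> (\<Sum>j\<in>V. real (q j) * t j (q j) / P)" using b by (rule_tac sum_mono) auto
      also have "\<dots> = (\<Sum>j\<in>V. real (q j) * t j (q j)) / P" by (simp add: sum_divide_distrib)
      also have "\<dots> \<le> real P * ?M / P"
        using total_area_le[OF assms(1) other] m by (intro divide_right_mono) (auto intro: order_trans)
      finally show ?thesis using P by simp
    qed
    ultimately have "?T \<le> L * sum m C + K * sum b V" "L * sum m C \<le> L * ?M" "K * sum b V \<le> K * ?M"
      using coeff by (auto intro: mult_left_mono)
    then show ?thesis by (simp add: distrib_right)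
  qed
qed

section \<open>The value of \<open>\<mu>\<close> and the competitive ratio\<close>

text \<open>Cleared of denominators, the balance equation is
  \<open>9 \<mu>^2 - 23 \<mu> + 6 = 0\<close>, whose smaller root is \<open>\<mu>\<close>.\<close>

lemma mu_facts:
  defines "\<mu> \<equiv> (23 - sqrt 313) / 18"
  shows "0 < \<mu>" "\<mu> < 1 / 2" "(1 - \<mu>) * (1 / \<mu> - 3 / 2) = 4 / 3" "1 / \<mu> < 3.391"
proof -
  have lo: "17.69 < sqrt 313" by (rule real_less_rsqrt) (simp add: power2_eq_square)
  \<comment> \<open>The last claim needs \<open>sqrt 313 < 23 - 18 / 3.391\<close>, which is about
    17.69183, hence the five decimals.\<close>
  have hi: "sqrt 313 < 17.69182" by (rule real_less_lsqrt) (simp_all add: power2_eq_square)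
  show pos: "0 < \<mu>" and "\<mu> < 1 / 2" using lo hi by (simp_all add: \<mu>_def)
  have "23 - 18 * \<mu> = sqrt 313" by (simp add: \<mu>_def field_simps)
  then have "(23 - 18 * \<mu>)\<^sup>2 = 313" by simp
  then have "9 * (\<mu> * \<mu>) - 23 * \<mu> + 6 = 0" by (simp add: power2_eq_square algebra_simps)
  then show "(1 - \<mu>) * (1 / \<mu> - 3 / 2) = 4 / 3" using pos by (simp add: divide_simps) (simp add: algebra_simps)
  have "1 < 3.391 * \<mu>" using hi by (simp add: \<mu>_def)
  then show "1 / \<mu> < 3.391" using pos by (simp add: pos_divide_less_eq)
qed

theorem theorem2:
  fixes P :: nat and V :: "'a set" and E :: "('a \<times> 'a) set" and w c :: "'a \<Rightarrow> real"
  assumes "P \<ge> 1"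
    and "finite V" and "E \<subseteq> V \<times> V" and "acyclic E"
    and "\<forall>j\<in>V. w j > 0 \<and> c j \<ge> 0"
  defines "t \<equiv> \<lambda>j. comm_time (w j) (c j)"
    and "\<alpha> \<equiv> 4 / 3 :: real" and "\<mu> \<equiv> (23 - sqrt 313) / 18"
  shows "18 / (23 - sqrt 313) < (3.391 :: real) \<and>
    (\<exists>p st. algorithm_output P V E w c \<alpha> \<mu> p st) \<and>
    (\<forall>p st. algorithm_output P V E w c \<alpha> \<mu> p st \<longrightarrow>
       dom st = V \<and>
       makespan V t p (\<lambda>j. the (st j)) \<le> 18 / (23 - sqrt 313) * opt_makespan P V E t)"
proof -
  have mu: "0 < \<mu>" "\<mu> < 1 / 2" "(1 - \<mu>) * (1 / \<mu> - 3 / 2) = 4 / 3" "1 / \<mu> < 3.391"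
    using mu_facts unfolding \<mu>_def by blast+
  have ratio: "18 / (23 - sqrt 313) = 1 / \<mu>" by (simp add: \<mu>_def)
  \<comment> \<open>Makes the work weight \<open>1 / \<mu> - 3 / 2\<close> positive.\<close>
  have two: "2 < 1 / \<mu>" using mu by (simp add: pos_less_divide_eq)
  have wc: "w j > 0" "c j \<ge> 0" if "j \<in> V" for j using assms(5) that by auto
  define allocated where "allocated p \<longleftrightarrow>
    (\<forall>j\<in>V. \<exists>p0. initial_allocation P \<alpha> (w j) (c j) p0 \<and> p j = final_allocation P \<mu> p0)" for p
  have out: "algorithm_output P V E w c \<alpha> \<mu> p st \<longleftrightarrow>
    allocated p \<and> (\<exists>\<tau> Q. list_scheduling P V E t p \<tau> Q st \<and> running t p st \<tau> = {})" for p st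
    by (simp add: algorithm_output_def allocated_def t_def)
  have bounds: "1 \<le> p j" "p j \<le> P" "real (p j) < \<mu> * P + 1"
    "real (p j) * t j (p j) \<le> 4 / 3 * w j"
    "t j (p j) \<le> 3 / 2 * t_min P (w j) (c j) + (1 / \<mu> - 3 / 2) * w j / P"
    if p: "allocated p" and j: "j \<in> V" for p j
  proof -
    obtain p0 where p0: "initial_allocation P (4 / 3) (w j) (c j) p0" "p j = final_allocation P \<mu> p0"
      using p j unfolding allocated_def \<alpha>_def by blast
    have "\<mu> < 1" "3 / 2 \<le> 1 / \<mu>" using mu(2) two by linarith+
    note fb = final_allocation_bounds[OF wc[OF j] assms(1) mu(1) this(1) p0]
      \<open>3 / 2 \<le> 1 / \<mu>\<close>
    show "1 \<le> p j" "p j \<le> P" "real (p j) < \<mu> * P + 1" by (fact fb)+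
    show "real (p j) * t j (p j) \<le> 4 / 3 * w j" unfolding t_def by (fact fb)
    show "t j (p j) \<le> 3 / 2 * t_min P (w j) (c j) + (1 / \<mu> - 3 / 2) * w j / P"
      unfolding t_def by (rule fb(5)) (fact fb)
  qed
  have tpos: "0 < t j k" if "j \<in> V" "1 \<le> k" for j k
    using that wc unfolding t_def by (intro comm_time_pos) auto
  have ls: "list_schedule P V E t p" if "allocated p" for p
    using assms(2-4) bounds(1,2)[OF that] tpos by unfold_locales blast+
  have ex: "\<exists>p st. algorithm_output P V E w c \<alpha> \<mu> p st"
  proof -
    have "\<forall>j\<in>V. \<exists>k. \<exists>p0. initial_allocation P \<alpha> (w j) (c j) p0 \<and> k = final_allocation P \<mu> p0"
      using initial_allocation_exists wc assms(1) unfolding \<alpha>_def by blast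
    from bchoice[OF this] obtain p where "allocated p" unfolding allocated_def by blast
    then show ?thesis using list_schedule.terminating_run_exists[OF ls] unfolding out by blast
  qed
  have main: "dom st = V \<and> makespan V t p (\<lambda>j. the (st j)) \<le> 1 / \<mu> * opt_makespan P V E t"
    if o: "algorithm_output P V E w c \<alpha> \<mu> p st" for p st
  proof -
    have p: "allocated p" using o out by blast
    obtain \<tau> Q where run: "list_scheduling P V E t p \<tau> Q st" "running t p st \<tau> = {}"
      using o out by blast
    let ?T = "makespan V t p (\<lambda>j. the (st j))"
    note props = list_schedule.output_dom_feasible_saturated[OF ls[OF p] run]
    have upper: "?T \<le> 1 / \<mu> * makespan V t q \<rho>" if fs: "feasible_schedule P V E t q \<rho>" for q \<rho>
    proof -
      have q: "1 \<le> q j" "q j \<le> P" if "j \<in> V" for j using fs that by (auto simp: feasible_schedule_def)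
      have "?T \<le> (3 / 2 + (1 / \<mu> - 3 / 2)) * makespan V t q \<rho>"
      proof (rule makespan_le_of_charging[where E = E and \<mu> = \<mu>
            and m = "\<lambda>j. t_min P (w j) (c j)" and b = "\<lambda>j. w j / P"])
        show "finite V" "wf E" "E \<subseteq> V \<times> V"
          using assms(2,3) list_schedule.wf_E[OF ls[OF p]] by blast+
        show "feasible_schedule P V E t p (\<lambda>j. the (st j))" using props(2) .
        show "feasible_schedule P V E t q \<rho>" using fs .
        show "P < (\<Sum>j | j \<in> V \<and> the (st j) \<le> x \<and> x < the (st j) + t j (p j). p j) + p j"
          if "j \<in> V" "0 \<le> x" "x < the (st j)"
            "\<And>i. (i, j) \<in> E \<Longrightarrow> the (st i) + t i (p i) \<le> x" for j x
          using that by (rule props(3))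
      next
        fix j assume j: "j \<in> V"
        show "0 < t j (p j)" using tpos bounds(1)[OF p] j by blast
        show "0 \<le> t_min P (w j) (c j)" using t_min_pos wc[OF j] assms(1) by (intro less_imp_le) auto
        show "t_min P (w j) (c j) \<le> t j (q j)"
          unfolding t_def using wc[OF j] q[OF j] by (intro t_min_le) auto
        show "0 \<le> w j / P" using wc[OF j] by simp
        \<comment> \<open>The overhead \<open>c * q * (q - 1)\<close> is nonnegative, so any
          schedule spends area at least \<open>w j\<close> on \<open>j\<close>.\<close>
        have "w j \<le> comm_area (w j) (c j) (q j)" using wc[OF j] q[OF j] by (simp add: comm_area_eq)
        then show "w j / P \<le> real (q j) * t j (q j) / P"
          by (intro divide_right_mono) (auto simp: comm_area_def t_def)
        show "t j (p j) \<le> 3 / 2 * t_min P (w j) (c j) + (1 / \<mu> - 3 / 2) * (w j / P)"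
          using bounds(5)[OF p j] by simp
        show "real (p j) < \<mu> * P + 1" using bounds(3)[OF p j] .
        \<comment> \<open>Here the choice of \<open>\<mu>\<close> enters:
          \<open>(1 - \<mu>) * K\<close> is exactly the area factor \<open>4 / 3\<close>.\<close>
        show "real (p j) * t j (p j) \<le> (1 - \<mu>) * (1 / \<mu> - 3 / 2) * P * (w j / P)"
          unfolding mu(3) using bounds(4)[OF p j] assms(1) by simp
      qed (use mu(2) two assms(1) in simp_all)
      then show ?thesis by simp
    qed
    have "?T * \<mu> \<le> opt_makespan P V E t"
      unfolding opt_makespan_def
    proof (rule cInf_greatest)
      \<comment> \<open>The schedule of the algorithm is itself feasible, so the infimum ranges over
        a nonempty set.\<close>
      show "{makespan V t q \<sigma> |q \<sigma>. feasible_schedule P V E t q \<sigma>} \<noteq> {}" using props(2) by blast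
    next
      fix x assume "x \<in> {makespan V t q \<sigma> |q \<sigma>. feasible_schedule P V E t q \<sigma>}"
      then have "?T \<le> 1 / \<mu> * x" using upper by blast
      then show "?T * \<mu> \<le> x" using mu(1) by (simp add: pos_le_divide_eq)
    qed
    then show ?thesis using props(1) mu(1) by (simp add: pos_le_divide_eq)
  qed
  show ?thesis unfolding ratio using mu(4) ex main by blast
qed

end
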